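(* Let $f:\mathbb{R}^n\to\mathbb{R}$ and $G:\mathbb{R}^n\to S^p$ be twice continuously differentiable, and let $(\bar x,\bar y)\in S_{\rm KKT}(0,0)$. Then the following are equivalent: (i) every $\xi\in\mathbb{R}^n$ satisfying $$\nabla^2_{xx}L(\bar x,\bar y)\xi=0,\qquad G'(\bar x)\xi-\Pi'_{S^p_+}\big(G(\bar x)+\bar y;\,G'(\bar x)\xi\big)=0$$ is $\xi=0$; (ii) there are numbers $\varepsilon>0$, $\ell>0$ and neighborhoods $U$ of $0\in\mathbb{R}^n$ and $W$ of $0\in S^p$ such that for any $(p_1,p_2)\in U\times W$ and any $(x_{p_1p_2},y_{p_1p_2})\in S_{\rm KKT}(p_1,p_2)\cap\mathbb{B}_\varepsilon(\bar x,\bar y)$, $$\|x_{p_1p_2}-\bar x\|\le\ell\big(\|p_1\|+\|p_2\|+\|y_{p_1p_2}-\bar y\|\big).$$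
   Context: $S^p$ is the space of real symmetric $p\times p$ matrices with the trace inner product; $S^p_+$ (resp. $S^p_-$) is the cone of positive (resp. negative) semidefinite matrices. The underlying problem is $\min f(x)$ s.t. $G(x)\in S^p_+$, with $L(x,y)=f(x)+\langle y,G(x)\rangle$ for $(x,y)\in\mathbb{R}^n\times S^p$. $G'(\bar x):\mathbb{R}^n\to S^p$ is the derivative. $N(x;\Omega)$ is the normal cone of convex analysis to the convex set $\Omega$ at $x\in\Omega$, and empty if $x\notin\Omega$. $\mathbb{B}_\varepsilon(\cdot)$ is the ball of radius $\varepsilon$. $\Pi_{S^p_+}$ is the metric projection onto $S^p_+$ and $\Pi'_{S^p_+}(Z;H)$ its directional derivative at $Z$ in direction $H$. For $(p_1,p_2)\in\mathbb{R}^n\times S^p$, the solution map of the canonically perturbed KKT system is $$S_{\rm KKT}(p_1,p_2)=\{(x,y)\in\mathbb{R}^n\times S^p:\ p_1=\nabla_xL(x,y),\ p_2\in -G(x)+N(y;S^p_-)\}.$$ *)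

theory Defs
  imports "HOL-Analysis.Analysis"
begin

text \<open>
  \<open>S\<^sup>p\<close> is the subspace \<open>sym_mats\<close> of \<open>real ^ 'p ^ 'p\<close>, with \<open>p = CARD('p)\<close>. The inner product
  that \<open>real ^ 'p ^ 'p\<close> carries in HOL-Analysis is the trace inner product, so its norm is
  the Frobenius norm.
\<close>

lemma inner_matrix_eq_trace:
  fixes A B :: "real ^ 'p ^ 'p"
  shows "A \<bullet> B = trace (transpose A ** B)"
proof -
  have "A \<bullet> B = (\<Sum>i\<in>UNIV. \<Sum>j\<in>UNIV. A $ i $ j * B $ i $ j)"
    by (simp add: inner_vec_def)
  also have "\<dots> = (\<Sum>j\<in>UNIV. \<Sum>i\<in>UNIV. A $ i $ j * B $ i $ j)"
    by (rule sum.swap)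
  also have "\<dots> = trace (transpose A ** B)"
    by (simp add: trace_def matrix_matrix_mult_def transpose_def)
  finally show ?thesis .
qed

definition sym_mats :: "(real ^ 'p ^ 'p) set" where
  "sym_mats = {A. transpose A = A}"

definition psd_cone :: "(real ^ 'p ^ 'p) set" where
  "psd_cone = {A \<in> sym_mats. \<forall>v. 0 \<le> v \<bullet> (A *v v)}"

definition nsd_cone :: "(real ^ 'p ^ 'p) set" where
  "nsd_cone = {A \<in> sym_mats. \<forall>v. v \<bullet> (A *v v) \<le> 0}"

text \<open>
  The normal cone is taken relative to a linear subspace \<open>E\<close> containing \<open>\<Omega>\<close>: for cones of
  symmetric matrices the normals have to be symmetric as well, and in the full matrix space
  the normal cone would also contain all skew-symmetric matrices.
\<close>

definition normal_cone :: "'a::real_inner set \<Rightarrow> 'a \<Rightarrow> 'a set \<Rightarrow> 'a set" where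
  "normal_cone E x \<Omega> = (if x \<in> \<Omega> then {v \<in> E. \<forall>z\<in>\<Omega>. v \<bullet> (z - x) \<le> 0} else {})"

definition twice_cont_diff :: "('a::real_normed_vector \<Rightarrow> 'b::real_normed_vector) \<Rightarrow> bool" where
  "twice_cont_diff f \<longleftrightarrow>
    (\<exists>(f' :: 'a \<Rightarrow> 'a \<Rightarrow>\<^sub>L 'b) (f'' :: 'a \<Rightarrow> 'a \<Rightarrow>\<^sub>L ('a \<Rightarrow>\<^sub>L 'b)).
      (\<forall>x. (f has_derivative blinfun_apply (f' x)) (at x)) \<and>
      (\<forall>x. (f' has_derivative blinfun_apply (f'' x)) (at x)) \<and>
      continuous_on UNIV f'')"

definition gradient :: "('a::real_inner \<Rightarrow> real) \<Rightarrow> 'a \<Rightarrow> 'a" where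
  "gradient f x = (THE D. GDERIV f x :> D)"

text \<open>The Hessian as a linear map: the derivative of the gradient mapping.\<close>

definition hessian :: "('a::real_inner \<Rightarrow> real) \<Rightarrow> 'a \<Rightarrow> 'a \<Rightarrow> 'a" where
  "hessian f x = frechet_derivative (gradient f) (at x)"

definition dir_deriv :: "('a::real_normed_vector \<Rightarrow> 'b::real_normed_vector) \<Rightarrow> 'a \<Rightarrow> 'a \<Rightarrow> 'b" where
  "dir_deriv F z h = Lim (at_right 0) (\<lambda>t::real. (F (z + t *\<^sub>R h) - F z) /\<^sub>R t)"

definition lagrangian ::
  "(real ^ 'n \<Rightarrow> real) \<Rightarrow> (real ^ 'n \<Rightarrow> real ^ 'p ^ 'p) \<Rightarrow> real ^ 'n \<Rightarrow> real ^ 'p ^ 'p \<Rightarrow> real" where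
  "lagrangian f G x y = f x + y \<bullet> G x"

text \<open>Multipliers are symmetric, since \<open>normal_cone sym_mats y nsd_cone\<close> is empty
  unless \<open>y \<in> nsd_cone\<close>.\<close>

definition S_KKT ::
  "(real ^ 'n \<Rightarrow> real) \<Rightarrow> (real ^ 'n \<Rightarrow> real ^ 'p ^ 'p) \<Rightarrow>
    real ^ 'n \<Rightarrow> real ^ 'p ^ 'p \<Rightarrow> ((real ^ 'n) \<times> (real ^ 'p ^ 'p)) set" where
  "S_KKT f G p\<^sub>1 p\<^sub>2 =
    {(x, y). p\<^sub>1 = gradient (\<lambda>u. lagrangian f G u y) x \<and>
             p\<^sub>2 \<in> (\<lambda>v. - G x + v) ` normal_cone sym_mats y nsd_cone}"

end

theory Submission
  imports Defs
begin

text \<open>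
  A pair \<open>(x, y)\<close> solves the perturbed system iff \<open>G x + p\<^sub>2 = \<Pi>(G x + p\<^sub>2 + y)\<close>, by Moreau's
  decomposition, so both implications come from dividing by \<open>t \<rightarrow> 0\<close> once \<open>\<Pi>\<close> is known to be
  directionally differentiable (it is nonexpansive, so the direction may vary as well).
  Directional differentiability is obtained without spectral perturbation theory: the difference
  quotients of \<open>\<Pi>\<close> are bounded, every cluster point satisfies a system of linear and
  complementarity conditions, and that system has at most one solution, because an eigenvector
  of the difference of two solutions for a nonzero eigenvalue would violate complementarity.
\<close>

section \<open>Positive semidefinite matrices\<close>

lemma sym_matsD: "A \<in> sym_mats \<Longrightarrow> (A *v u) \<bullet> v = u \<bullet> (A *v v)"
  by (metis (mono_tags, lifting) dot_lmul_matrix mem_Collect_eq sym_mats_def transpose_matrix_vector)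

lemma subspace_sym_mats: "subspace sym_mats"
  by (auto simp: subspace_def sym_mats_def transpose_def vec_eq_iff)

lemma psd_sym: "A \<in> psd_cone \<Longrightarrow> A \<in> sym_mats"
  by (simp add: psd_cone_def)

lemma psd_nonneg: "A \<in> psd_cone \<Longrightarrow> 0 \<le> v \<bullet> (A *v v)"
  by (simp add: psd_cone_def)

lemma mv_uminus: "(- A) *v v = - (A *v v)" for A :: "real ^ 'n ^ 'm"
  by (simp add: vec_eq_iff matrix_vector_mult_def sum_negf)

lemmas mv_simps = matrix_vector_mult_add_rdistrib matrix_vector_mult_diff_rdistrib
  matrix_vector_right_distrib matrix_vector_mult_diff_distrib matrix_vector_mult_scaleR
  mv_uminus scaleR_matrix_vector_assoc[symmetric]

lemma nsd_iff: "A \<in> nsd_cone \<longleftrightarrow> - A \<in> psd_cone"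
  using subspace_neg[OF subspace_sym_mats, of A] subspace_neg[OF subspace_sym_mats, of "-A"]
  by (auto simp: nsd_cone_def psd_cone_def mv_uminus)

lemma psd_add: "A \<in> psd_cone \<Longrightarrow> B \<in> psd_cone \<Longrightarrow> A + B \<in> psd_cone"
  by (auto simp: psd_cone_def mv_simps inner_add_right subspace_add[OF subspace_sym_mats])

lemma psd_scale: "A \<in> psd_cone \<Longrightarrow> 0 \<le> c \<Longrightarrow> c *\<^sub>R A \<in> psd_cone"
  by (auto simp: psd_cone_def mv_simps subspace_scale[OF subspace_sym_mats])

lemma psd_zero: "0 \<in> psd_cone"
  by (auto simp: psd_cone_def subspace_0[OF subspace_sym_mats])

lemma tendsto_mv:
  fixes M :: "'c \<Rightarrow> real ^ 'n ^ 'm"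
  assumes "(M \<longlongrightarrow> A) F" "(w \<longlongrightarrow> v) F"
  shows "((\<lambda>n. M n *v w n) \<longlongrightarrow> A *v v) F"
  unfolding matrix_vector_mult_def
  by (intro vec_tendstoI) (auto intro!: tendsto_intros assms)

lemma closed_sym_mats: "closed sym_mats"
  by (rule closed_subspace[OF subspace_sym_mats])

lemma closed_psd: "closed psd_cone"
  unfolding closed_sequential_limits
proof (intro allI impI, elim conjE)
  fix X and A :: "real ^ 'a ^ 'a"
  assume X: "\<forall>n. X n \<in> psd_cone" and lim: "X \<longlonglongrightarrow> A"
  have "A \<in> sym_mats"
    using closed_sequentially[OF closed_sym_mats _ lim] X psd_sym by blast
  moreover have "0 \<le> v \<bullet> (A *v v)" for v
  proof (rule LIMSEQ_le_const)
    show "(\<lambda>n. v \<bullet> (X n *v v)) \<longlonglongrightarrow> v \<bullet> (A *v v)"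
      by (intro tendsto_intros tendsto_mv lim)
  qed (use X psd_nonneg in blast)
  ultimately show "A \<in> psd_cone" by (simp add: psd_cone_def)
qed

lemma convex_psd: "convex psd_cone"
  by (auto intro!: convexI psd_add psd_scale)

section \<open>Cauchy-Schwarz inequality for semidefinite forms\<close>

lemma psd_Cauchy_Schwarz:
  assumes A: "A \<in> psd_cone"
  shows "(u \<bullet> (A *v v))\<^sup>2 \<le> (u \<bullet> (A *v u)) * (v \<bullet> (A *v v))"
proof -
  define a b c where "a = u \<bullet> (A *v u)" and "b = u \<bullet> (A *v v)" and "c = v \<bullet> (A *v v)"
  \<comment> \<open>The form at \<open>s *\<^sub>R u + v\<close> is a nonnegative quadratic in
    \<open>s\<close>, so its discriminant cannot be positive.\<close>
  have q: "0 \<le> a * s\<^sup>2 + 2 * b * s + c" for s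
  proof -
    have "v \<bullet> (A *v u) = b"
      using sym_matsD[OF psd_sym[OF A], of v u] by (simp add: b_def inner_commute)
    then have "(s *\<^sub>R u + v) \<bullet> (A *v (s *\<^sub>R u + v)) = a * s\<^sup>2 + 2 * b * s + c"
      by (simp add: mv_simps inner_add_left inner_add_right a_def b_def c_def power2_eq_square algebra_simps)
    then show ?thesis using psd_nonneg[OF A, of "s *\<^sub>R u + v"] by simp
  qed
  have "b\<^sup>2 \<le> a * c"
  proof (cases "a = 0")
    case True
    have "b = 0"
    proof (rule ccontr)
      assume "b \<noteq> 0"
      \<comment> \<open>With \<open>a = 0\<close> the quadratic is affine, and this \<open>s\<close>
        makes it equal to -1.\<close>
      then show False using q[of "- (c + 1) / (2 * b)"] True by (simp add: field_simps)
    qed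
    then show ?thesis using True by simp
  next
    case False
    then have "a > 0" using psd_nonneg[OF A, of u] by (simp add: a_def)
    then show ?thesis using q[of "- b / a"]
      by (simp add: field_simps power2_eq_square)
  qed
  then show ?thesis by (simp add: a_def b_def c_def)
qed

text \<open>Cauchy-Schwarz against \<open>u = A *v v\<close> bounds the fourth power of the norm of
  \<open>A *v v\<close> by zero.\<close>

lemma psd_null:
  assumes "A \<in> psd_cone" "v \<bullet> (A *v v) = 0"
  shows "A *v v = 0"
  using psd_Cauchy_Schwarz[OF assms(1), of "A *v v" v] assms(2) by simp

section \<open>Rank-one decompositions and the trace inner product\<close>

definition rank1 :: "real ^ 'n \<Rightarrow> real ^ 'n ^ 'n" where
  "rank1 w = (\<chi> i j. w $ i * w $ j)"

lemma rank1_mv: "rank1 w *v v = (w \<bullet> v) *\<^sub>R w"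
  by (simp add: vec_eq_iff matrix_vector_mult_def rank1_def inner_vec_def sum_distrib_right
      sum_distrib_left mult_ac)

lemma rank1_inner: "rank1 w \<bullet> B = w \<bullet> (B *v w)"
  by (simp add: matrix_vector_mult_def rank1_def inner_vec_def sum_distrib_right
      sum_distrib_left mult_ac)

lemma rank1_sym: "rank1 w \<in> sym_mats"
  by (simp add: sym_mats_def rank1_def transpose_def vec_eq_iff mult.commute)

lemma rank1_psd: "rank1 w \<in> psd_cone"
  by (simp add: psd_cone_def rank1_sym rank1_mv inner_commute)

text \<open>Cholesky elimination: the pivot step kills one more coordinate.\<close>

lemma psd_decomposition_aux:
  fixes A :: "real ^ 'p ^ 'p"
  assumes "finite S" "A \<in> psd_cone" "\<And>i. i \<notin> S \<Longrightarrow> A *v axis i 1 = 0"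
  shows "\<exists>ws. A = sum_list (map rank1 ws)"
  using assms
proof (induction S arbitrary: A rule: finite_induct)
  case empty
  then have "A *v axis i 1 = 0" for i by simp
  then have "A = 0"
    by (simp add: vec_eq_iff matrix_vector_mult_basis column_def)
  then show ?case by (intro exI[of _ "[]"]) simp
next
  case (insert i S)
  let ?e = "axis i 1 :: real ^ 'p"
  define a where "a = ?e \<bullet> (A *v ?e)"
  show ?case
  proof (cases "a = 0")
    case True
    \<comment> \<open>A zero pivot forces its whole column to vanish, so nothing has to be
      subtracted.\<close>
    then have "A *v ?e = 0" using psd_null[OF insert.prems(1)] by (simp add: a_def)
    then have "A *v axis j 1 = 0" if "j \<notin> S" for j
      using insert.prems(2)[of j] that by (cases "j = i") auto
    then show ?thesis using insert.IH[OF insert.prems(1)] by blast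
  next
    case False
    then have a: "a > 0" using psd_nonneg[OF insert.prems(1), of ?e] by (simp add: a_def)
    \<comment> \<open>With this scaling \<open>A - rank1 w\<close> is the Schur complement of the
      pivot: Cauchy-Schwarz keeps it semidefinite, and it annihilates \<open>?e\<close> along with
      every basis vector that \<open>A\<close> annihilates.\<close>
    define w where "w = (1 / sqrt a) *\<^sub>R (A *v ?e)"
    have w: "w \<bullet> v = (?e \<bullet> (A *v v)) / sqrt a" for v
      using sym_matsD[OF psd_sym[OF insert.prems(1)], of ?e v] by (simp add: w_def)
    define A' where "A' = A - rank1 w"
    have "A' \<in> sym_mats"
      by (simp add: A'_def subspace_diff[OF subspace_sym_mats] rank1_sym psd_sym insert.prems)
    moreover have "0 \<le> v \<bullet> (A' *v v)" for v
    proof -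
      have "(w \<bullet> v)\<^sup>2 \<le> v \<bullet> (A *v v)"
        using psd_Cauchy_Schwarz[OF insert.prems(1), of ?e v] a
        by (simp add: w power_divide a_def[symmetric] field_simps)
      then show ?thesis
        by (simp add: A'_def mv_simps rank1_mv inner_diff_right inner_commute power2_eq_square)
    qed
    ultimately have psd': "A' \<in> psd_cone" by (simp add: psd_cone_def)
    have "A' *v axis j 1 = 0" if "j \<notin> S" for j
    proof (cases "j = i")
      case True
      have "(w \<bullet> ?e) *\<^sub>R w = A *v ?e"
        unfolding w using a by (simp add: w_def a_def[symmetric])
      then show ?thesis by (simp add: True A'_def mv_simps rank1_mv)
    next
      case False
      then have "A *v axis j 1 = 0" using insert.prems(2) that by blast
      then show ?thesis by (simp add: A'_def mv_simps rank1_mv w)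
    qed
    then obtain ws where "A' = sum_list (map rank1 ws)" using insert.IH[OF psd'] by blast
    then have "A = sum_list (map rank1 (w # ws))" by (simp add: A'_def algebra_simps)
    then show ?thesis by blast
  qed
qed

lemma psd_decomposition:
  assumes "A \<in> psd_cone"
  obtains ws where "A = sum_list (map rank1 ws)"
  using psd_decomposition_aux[of UNIV A] assms by auto

text \<open>A rank-one decomposition of \<open>A\<close> turns the inner product into a sum of
  values \<open>w \<bullet> (B *v w)\<close>.\<close>

lemma psd_inner_nonneg:
  assumes "A \<in> psd_cone" "B \<in> psd_cone"
  shows "0 \<le> A \<bullet> B"
proof -
  obtain ws where A: "A = sum_list (map rank1 ws)" using psd_decomposition assms(1) by blast
  show ?thesis unfolding A
    by (induction ws) (auto simp: inner_add_left rank1_inner intro!: add_nonneg_nonneg psd_nonneg assms)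
qed

text \<open>The nonnegative values \<open>w \<bullet> (B *v w)\<close> that sum to
  \<open>A \<bullet> B\<close> all vanish, so \<open>B\<close> annihilates every \<open>w\<close> of
  the decomposition and hence the range of \<open>A\<close>. Complementarity thereby becomes a
  matrix identity that can be expanded in powers of \<open>t\<close>.\<close>

lemma psd_inner_zero_mult:
  assumes "A \<in> psd_cone" "B \<in> psd_cone" "A \<bullet> B = 0"
  shows "B *v (A *v v) = 0"
proof -
  obtain ws where A: "A = sum_list (map rank1 ws)" using psd_decomposition assms(1) by blast
  have nn: "0 \<le> sum_list (map rank1 us) \<bullet> B" for us
    by (induction us) (auto simp: inner_add_left rank1_inner intro!: add_nonneg_nonneg psd_nonneg assms)
  have "sum_list (map rank1 ws) \<bullet> B = 0 \<Longrightarrow> B *v (sum_list (map rank1 ws) *v v) = 0"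
  proof (induction ws)
    case (Cons w ws)
    have "w \<bullet> (B *v w) = 0 \<and> sum_list (map rank1 ws) \<bullet> B = 0"
      using Cons.prems nn[of ws] psd_nonneg[OF assms(2), of w]
      by (simp add: inner_add_left rank1_inner)
    then show ?case using Cons.IH psd_null[OF assms(2)]
      by (simp add: mv_simps rank1_mv)
  qed simp
  then show ?thesis using A assms(3) by simp
qed

section \<open>Eigenvectors from the Rayleigh quotient\<close>

lemma sym_positive_eigenvalue:
  fixes M :: "real ^ 'p ^ 'p"
  assumes M: "M \<in> sym_mats" and pos: "0 < u \<bullet> (M *v u)"
  shows "\<exists>c v. c > 0 \<and> v \<noteq> 0 \<and> M *v v = c *\<^sub>R v"
proof -
  let ?q = "\<lambda>v. v \<bullet> (M *v v)"
  have cont: "continuous_on (sphere 0 1) ?q"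
    unfolding continuous_on_def by (intro ballI tendsto_intros tendsto_mv)
  have u: "u \<noteq> 0" using pos by auto
  then have u1: "u /\<^sub>R norm u \<in> sphere 0 1" by simp
  \<comment> \<open>The maximizer on the unit sphere is the eigenvector: with \<open>c\<close> the
    maximum, \<open>c *\<^sub>R mat 1 - M\<close> is semidefinite by homogeneity and its form
    vanishes at \<open>v\<close>, so \<open>psd_null\<close> applies.\<close>
  obtain v where v: "v \<in> sphere 0 1" and max: "\<And>w. w \<in> sphere 0 1 \<Longrightarrow> ?q w \<le> ?q v"
    using continuous_attains_sup[OF compact_sphere _ cont] u1 by blast
  define c where "c = ?q v"
  have le: "?q w \<le> c * (w \<bullet> w)" for w
  proof (cases "w = 0")
    case False
    then have "?q (w /\<^sub>R norm w) \<le> c" using max[of "w /\<^sub>R norm w"] by (simp add: c_def)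
    then have "?q w / (norm w)\<^sup>2 \<le> c" by (simp add: mv_simps power2_eq_square divide_inverse mult_ac)
    then show ?thesis using False by (simp add: pos_divide_le_eq dot_square_norm)
  qed simp
  have "0 < c * (u \<bullet> u)" using le[of u] pos by linarith
  then have "c > 0" using zero_less_mult_pos2 u by (metis inner_gt_zero_iff)
  let ?N = "c *\<^sub>R mat 1 - M"
  have id: "mat 1 \<in> sym_mats" by (simp add: sym_mats_def)
  have "?N \<in> psd_cone"
    using le by (simp add: psd_cone_def subspace_diff[OF subspace_sym_mats]
        subspace_scale[OF subspace_sym_mats] id M mv_simps inner_diff_right)
  moreover have "v \<bullet> (?N *v v) = 0"
    using v by (simp add: mv_simps inner_diff_right c_def[symmetric] dot_square_norm)
  ultimately have "?N *v v = 0" by (rule psd_null)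
  then have "M *v v = c *\<^sub>R v" by (simp add: mv_simps)
  moreover have "v \<noteq> 0" using v by auto
  ultimately show ?thesis using \<open>c > 0\<close> by blast
qed

text \<open>If the form of \<open>M\<close> vanished identically, \<open>M\<close> would be
  semidefinite with every vector in its kernel, hence zero. So \<open>M\<close> or
  \<open>- M\<close> takes a positive value.\<close>

lemma sym_nonzero_eigenvector:
  fixes M :: "real ^ 'p ^ 'p"
  assumes M: "M \<in> sym_mats" and "M \<noteq> 0"
  obtains c v where "c \<noteq> 0" "v \<noteq> 0" "M *v v = c *\<^sub>R v"
proof -
  have "\<exists>u. u \<bullet> (M *v u) \<noteq> 0"
  proof (rule ccontr)
    assume "\<nexists>u. u \<bullet> (M *v u) \<noteq> 0"
    then have "M \<in> psd_cone" "\<And>u. u \<bullet> (M *v u) = 0" using M by (auto simp: psd_cone_def)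
    then have "M *v u = 0" for u using psd_null by blast
    then show False using \<open>M \<noteq> 0\<close> by (metis matrix_eq matrix_vector_mult_0)
  qed
  then obtain u where "u \<bullet> (M *v u) \<noteq> 0" by blast
  then consider "0 < u \<bullet> (M *v u)" | "0 < u \<bullet> ((- M) *v u)" by (fastforce simp: mv_uminus)
  then show thesis
  proof cases
    case 1
    then show thesis using sym_positive_eigenvalue[OF M] that by (metis less_irrefl)
  next
    case 2
    have "- M \<in> sym_mats" using subspace_neg[OF subspace_sym_mats M] .
    then obtain c v where "c > 0" "v \<noteq> 0" "(- M) *v v = c *\<^sub>R v"
      using sym_positive_eigenvalue 2 by blast
    then show thesis using that[of "- c" v] by (simp add: mv_uminus) (metis add.inverse_inverse)
  qed
qed

section \<open>Directional differentiability of the projection\<close>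

text \<open>Distances are measured among all matrices; at symmetric arguments this is the projection
  within the symmetric ones, as the cone is contained in that subspace.\<close>

abbreviation (input) psd_proj :: "real ^ 'p ^ 'p \<Rightarrow> real ^ 'p ^ 'p" where
  "psd_proj \<equiv> closest_point psd_cone"

section \<open>Moreau decomposition and the normal cone\<close>

lemma psd_proj_in: "psd_proj Z \<in> psd_cone"
  using closest_point_in_set[OF closed_psd] psd_zero by blast

lemma psd_proj_lipschitz: "norm (psd_proj Y - psd_proj Z) \<le> norm (Y - Z)"
  using closest_point_lipschitz[OF convex_psd closed_psd] psd_zero by (auto simp: dist_norm)

text \<open>The variational inequality of the projection is tested at three kinds of points: adding
  \<open>rank1 v\<close> gives semidefiniteness of the residual, while doubling the projection and
  taking \<open>0\<close> give the two halves of orthogonality.\<close>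

lemma psd_proj_complementary:
  assumes Z: "Z \<in> sym_mats"
  shows "psd_proj Z - Z \<in> psd_cone" "psd_proj Z \<bullet> (psd_proj Z - Z) = 0"
proof -
  let ?A = "psd_proj Z"
  have var: "(Z - ?A) \<bullet> (S - ?A) \<le> 0" if "S \<in> psd_cone" for S
    by (rule closest_point_dot[OF convex_psd closed_psd that])
  have "0 \<le> v \<bullet> ((?A - Z) *v v)" for v
    using var[OF psd_add[OF psd_proj_in[of Z] rank1_psd[of v]]]
    by (simp add: rank1_inner[symmetric] inner_diff_right inner_diff_left inner_commute)
  then show "?A - Z \<in> psd_cone"
    using subspace_diff[OF subspace_sym_mats psd_sym[OF psd_proj_in] Z] by (simp add: psd_cone_def)
  show "?A \<bullet> (?A - Z) = 0"
    using var[OF psd_add[OF psd_proj_in[of Z] psd_proj_in[of Z]]] var[OF psd_zero]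
    by (simp add: inner_diff_right inner_diff_left inner_commute)
qed

text \<open>Converse of the Moreau decomposition: in the expanded squared distance from
  \<open>Z\<close> to \<open>S\<close>, orthogonality leaves only the cross term
  \<open>S \<bullet> (A - Z)\<close>, which is nonnegative on the cone.\<close>

lemma psd_proj_unique:
  assumes A: "A \<in> psd_cone" and AZ: "A - Z \<in> psd_cone" and orth: "A \<bullet> (A - Z) = 0"
  shows "A = psd_proj Z"
proof (rule closest_point_unique[OF convex_psd closed_psd A], rule ballI)
  fix S :: "real ^ 'a ^ 'a" assume S: "S \<in> psd_cone"
  have "(norm (Z - S))\<^sup>2 = (norm (Z - A))\<^sup>2 + (norm (A - S))\<^sup>2 + 2 * (S \<bullet> (A - Z)) - 2 * (A \<bullet> (A - Z))"
    by (simp add: power2_norm_eq_inner inner_diff_right inner_diff_left inner_commute)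
  then have "(norm (Z - A))\<^sup>2 \<le> (norm (Z - S))\<^sup>2"
    using psd_inner_nonneg[OF S AZ] orth by simp
  then show "dist Z A \<le> dist Z S" by (simp add: dist_norm power2_le_iff_abs_le)
qed

text \<open>Both sides say that \<open>A\<close> and \<open>- y\<close> are semidefinite and
  orthogonal, which is the Moreau decomposition of \<open>A + y\<close>. The inclusion of the KKT
  system thus becomes an equation for the projection.\<close>

lemma normal_cone_nsd_iff:
  "A \<in> normal_cone sym_mats y nsd_cone \<longleftrightarrow> y \<in> sym_mats \<and> A = psd_proj (A + y)"
proof
  assume N: "A \<in> normal_cone sym_mats y nsd_cone"
  then have y: "- y \<in> psd_cone" and A: "A \<in> sym_mats"
    and var: "\<And>z. - z \<in> psd_cone \<Longrightarrow> A \<bullet> (z - y) \<le> 0"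
    by (auto simp: normal_cone_def nsd_iff split: if_splits)
  have "0 \<le> v \<bullet> (A *v v)" for v
    using var[of "y - rank1 v"] psd_add[OF y rank1_psd[of v]]
    by (simp add: rank1_inner[symmetric] inner_commute)
  then have psd: "A \<in> psd_cone" using A by (simp add: psd_cone_def)
  \<comment> \<open>The points \<open>0\<close> and \<open>2 *\<^sub>R y\<close> of the ray through
    \<open>y\<close> give opposite inequalities.\<close>
  have "A \<bullet> y = 0" using var[of 0] var[of "2 *\<^sub>R y"] psd_zero psd_scale[OF y, of 2]
    by (simp add: inner_diff_right)
  then show "y \<in> sym_mats \<and> A = psd_proj (A + y)"
    using psd_proj_unique[of A "A + y"] psd y psd_sym[OF y] subspace_neg[OF subspace_sym_mats, of "- y"]
    by simp
next
  assume R: "y \<in> sym_mats \<and> A = psd_proj (A + y)"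
  then have psd: "A \<in> psd_cone" using psd_proj_in[of "A + y"] by simp
  then have "A + y \<in> sym_mats" using R psd_sym subspace_add[OF subspace_sym_mats] by blast
  from psd_proj_complementary[OF this] R have y: "- y \<in> psd_cone" and "A \<bullet> y = 0" by simp_all
  moreover have "A \<bullet> z \<le> 0" if "- z \<in> psd_cone" for z
    using psd_inner_nonneg[OF psd that] by simp
  ultimately show "A \<in> normal_cone sym_mats y nsd_cone"
    using psd_sym[OF psd] by (simp add: normal_cone_def nsd_iff inner_diff_right)
qed

text \<open>
  The conditions on a derivative \<open>D\<close> of the projection in direction \<open>H\<close>, obtained by
  differentiating \<open>A\<^sub>t B\<^sub>t = 0\<close> for \<open>A\<^sub>t = \<Pi>(Z + t H)\<close>, \<open>B\<^sub>t = A\<^sub>t - Z - t H\<close>; on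
  \<open>ker A \<inter> ker B\<close> the first-order condition is void and the second-order one takes over.
\<close>

definition psd_proj_tangent where
  "psd_proj_tangent A B H D \<longleftrightarrow> D \<in> sym_mats \<and>
    (\<forall>v. D *v (B *v v) + A *v ((D - H) *v v) = 0) \<and>
    (\<forall>v. A *v v = 0 \<longrightarrow> B *v v = 0 \<longrightarrow>
      0 \<le> v \<bullet> (D *v v) \<and> 0 \<le> v \<bullet> ((D - H) *v v) \<and> (D *v v) \<bullet> ((D - H) *v v) = 0)"

text \<open>An eigenvector \<open>v\<close> of \<open>D - E\<close> with eigenvalue
  \<open>c \<noteq> 0\<close> lies in both kernels, by the difference of the first-order conditions.
  There, for \<open>c > 0\<close>, second-order complementarity would equate zero with
  \<open>c * c * (v \<bullet> v)\<close> plus nonnegative terms.\<close>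

lemma psd_proj_tangent_unique:
  assumes A: "A \<in> psd_cone" and B: "B \<in> psd_cone"
    and D: "psd_proj_tangent A B H D" and E: "psd_proj_tangent A B H E"
  shows "D = E"
proof (rule ccontr)
  assume "D \<noteq> E"
  then have "D - E \<noteq> 0" by simp
  moreover have "D - E \<in> sym_mats"
    using D E by (auto simp: psd_proj_tangent_def subspace_diff[OF subspace_sym_mats])
  ultimately obtain c v where c: "c \<noteq> 0" and v: "v \<noteq> 0" and eig: "(D - E) *v v = c *\<^sub>R v"
    using sym_nonzero_eigenvector by blast
  have Dv: "D *v v = E *v v + c *\<^sub>R v" using eig by (simp add: mv_simps algebra_simps)
  have "(D - E) *v (B *v v) + A *v ((D - E) *v v) = 0"
  proof -
    have "(D - E) *v (B *v v) + A *v ((D - E) *v v) =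
      (D *v (B *v v) + A *v ((D - H) *v v)) - (E *v (B *v v) + A *v ((E - H) *v v))"
      by (simp add: mv_simps)
    then show ?thesis using D E unfolding psd_proj_tangent_def by simp
  qed
  then have "v \<bullet> ((D - E) *v (B *v v)) + v \<bullet> (A *v ((D - E) *v v)) = 0"
    by (metis inner_add_right inner_zero_right)
  moreover have "v \<bullet> ((D - E) *v (B *v v)) = c * (v \<bullet> (B *v v))"
    using sym_matsD[OF \<open>D - E \<in> sym_mats\<close>, of v "B *v v"] eig by simp
  ultimately have "c * (v \<bullet> (B *v v) + v \<bullet> (A *v v)) = 0"
    unfolding eig by (simp add: matrix_vector_mult_scaleR distrib_left)
  then have "v \<bullet> (B *v v) + v \<bullet> (A *v v) = 0" using c by simp
  then have "v \<bullet> (B *v v) = 0" "v \<bullet> (A *v v) = 0"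
    using psd_nonneg[OF A, of v] psd_nonneg[OF B, of v] by linarith+
  then have ker: "A *v v = 0" "B *v v = 0" using psd_null A B by blast+
  \<comment> \<open>\<open>D\<close>, \<open>E\<close> and \<open>c\<close> are generalized so that
    exchanging the two solutions covers negative eigenvalues.\<close>
  have *: False if "psd_proj_tangent A B H D" "psd_proj_tangent A B H E"
      "D *v v = E *v v + c *\<^sub>R v" "c > 0" for D E c
  proof -
    have nn: "0 \<le> v \<bullet> (E *v v)" "0 \<le> v \<bullet> ((E - H) *v v)"
      and z: "(D *v v) \<bullet> ((D - H) *v v) = 0" "(E *v v) \<bullet> ((E - H) *v v) = 0"
      using that(1,2) ker by (auto simp: psd_proj_tangent_def)
    have "(D - H) *v v = (E - H) *v v + c *\<^sub>R v" using that(3) by (simp add: mv_simps)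
    then have "0 = (E *v v + c *\<^sub>R v) \<bullet> ((E - H) *v v + c *\<^sub>R v)" using z(1) that(3) by simp
    also have "\<dots> = c * (v \<bullet> ((E - H) *v v)) + c * (v \<bullet> (E *v v)) + c * c * (v \<bullet> v)"
      using z(2) by (simp add: inner_add_left inner_add_right inner_commute distrib_left)
    also have "\<dots> > 0" using nn \<open>c > 0\<close> v by (simp add: add_nonneg_pos)
    finally show False by simp
  qed
  show False
  proof (cases "c > 0")
    case True
    then show False using *[OF D E Dv] by simp
  next
    case False
    then show False using *[OF E D, of "- c"] c Dv by simp
  qed
qed

text \<open>The Moreau decomposition at \<open>Z + t n *\<^sub>R H\<close> has parts
  \<open>A + t n *\<^sub>R Q n\<close> and, up to sign, \<open>B + t n *\<^sub>R (Q n - H)\<close>.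
  Their semidefiniteness and zero product, divided by \<open>t n\<close>, give the conditions in the
  limit.\<close>

lemma psd_proj_quotient_tangent:
  assumes Z: "Z \<in> sym_mats" and H: "H \<in> sym_mats"
    and t: "\<And>n. 0 < t n" "t \<longlonglongrightarrow> 0"
    and lim: "(\<lambda>n. (psd_proj (Z + t n *\<^sub>R H) - psd_proj Z) /\<^sub>R t n) \<longlonglongrightarrow> D"
  shows "psd_proj_tangent (psd_proj Z) (psd_proj Z - Z) H D"
proof -
  define A B where "A = psd_proj Z" and "B = psd_proj Z - Z"
  define Q where "Q = (\<lambda>n. (psd_proj (Z + t n *\<^sub>R H) - psd_proj Z) /\<^sub>R t n)"
  have Q: "Q \<longlonglongrightarrow> D" using lim by (simp add: Q_def)
  have A: "A \<in> psd_cone" by (simp add: A_def psd_proj_in)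
  have B: "B \<in> psd_cone" "A \<bullet> B = 0"
    using psd_proj_complementary[OF Z] by (simp_all add: A_def B_def)
  have AB: "A *v (B *v v) = 0" for v
    using psd_inner_zero_mult[OF B(1) A] B(2) by (simp add: inner_commute)
  have Zt: "Z + t n *\<^sub>R H \<in> sym_mats" for n
    by (intro subspace_add[OF subspace_sym_mats] subspace_scale[OF subspace_sym_mats] Z H)
  have An: "psd_proj (Z + t n *\<^sub>R H) = A + t n *\<^sub>R Q n" for n
    using t(1)[of n] by (simp add: Q_def A_def)
  have Bn: "psd_proj (Z + t n *\<^sub>R H) - (Z + t n *\<^sub>R H) = B + t n *\<^sub>R (Q n - H)" for n
    by (simp add: An A_def B_def scaleR_diff_right)
  have psdA: "A + t n *\<^sub>R Q n \<in> psd_cone" for n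
    using psd_proj_in[of "Z + t n *\<^sub>R H"] by (simp add: An)
  have psdB: "B + t n *\<^sub>R (Q n - H) \<in> psd_cone"
    and orth: "(A + t n *\<^sub>R Q n) \<bullet> (B + t n *\<^sub>R (Q n - H)) = 0" for n
    using psd_proj_complementary[OF Zt[of n]] unfolding Bn by (simp_all add: An)
  have Qsym: "Q n \<in> sym_mats" for n
    unfolding Q_def by (intro subspace_scale[OF subspace_sym_mats] subspace_diff[OF subspace_sym_mats]
        psd_sym psd_proj_in)
  \<comment> \<open>The product of \<open>A\<close> and \<open>B\<close> is zero, so one factor
    \<open>t n\<close> divides out; the quadratic term retains another.\<close>
  have eq: "Q n *v (B *v v) + A *v ((Q n - H) *v v) + t n *\<^sub>R (Q n *v ((Q n - H) *v v)) = 0"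
    (is "?L = 0") for n v
  proof -
    have "(A + t n *\<^sub>R Q n) *v ((B + t n *\<^sub>R (Q n - H)) *v v) = 0"
      using psd_inner_zero_mult[OF psdB psdA] orth by (simp add: inner_commute)
    moreover have "(A + t n *\<^sub>R Q n) *v ((B + t n *\<^sub>R (Q n - H)) *v v) = t n *\<^sub>R ?L"
      using AB[of v] by (simp add: mv_simps scaleR_add_right scaleR_diff_right)
    ultimately show ?thesis using t(1)[of n] by simp
  qed
  have Dsym: "D \<in> sym_mats"
    using closed_sequentially[OF closed_sym_mats _ Q] Qsym by blast
  have first: "D *v (B *v v) + A *v ((D - H) *v v) = 0" for v
  proof -
    have "(\<lambda>n. Q n *v (B *v v) + A *v ((Q n - H) *v v) + t n *\<^sub>R (Q n *v ((Q n - H) *v v)))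
        \<longlonglongrightarrow> D *v (B *v v) + A *v ((D - H) *v v) + 0 *\<^sub>R (D *v ((D - H) *v v))"
      by (intro tendsto_intros tendsto_mv Q t(2))
    then show ?thesis unfolding eq by (simp add: LIMSEQ_const_iff)
  qed
  have second: "0 \<le> v \<bullet> (D *v v) \<and> 0 \<le> v \<bullet> ((D - H) *v v) \<and> (D *v v) \<bullet> ((D - H) *v v) = 0"
    if ker: "A *v v = 0" "B *v v = 0" for v
  proof (intro conjI)
    have "0 \<le> v \<bullet> (Q n *v v)" for n
      using psd_nonneg[OF psdA[of n], of v] ker t(1)[of n] by (simp add: mv_simps zero_le_mult_iff)
    then show "0 \<le> v \<bullet> (D *v v)"
      by (intro LIMSEQ_le_const[of "\<lambda>n. v \<bullet> (Q n *v v)"] tendsto_intros tendsto_mv Q) auto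
    have "0 \<le> v \<bullet> ((Q n - H) *v v)" for n
    proof -
      have "v \<bullet> ((B + t n *\<^sub>R (Q n - H)) *v v) = t n * (v \<bullet> ((Q n - H) *v v))"
        using ker by (simp add: matrix_vector_mult_add_rdistrib scaleR_matrix_vector_assoc[symmetric])
      then show ?thesis using psd_nonneg[OF psdB[of n], of v] t(1)[of n]
        by (simp add: zero_le_mult_iff)
    qed
    then show "0 \<le> v \<bullet> ((D - H) *v v)"
      by (intro LIMSEQ_le_const[of "\<lambda>n. v \<bullet> ((Q n - H) *v v)"] tendsto_intros tendsto_mv Q) auto
    \<comment> \<open>Pairing \<open>eq\<close> with a vector of both kernels removes the
      first-order terms, so the factor \<open>t n\<close> of the quadratic term cancels.\<close>
    have "(Q n *v v) \<bullet> ((Q n - H) *v v) = 0" for n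
    proof -
      have "v \<bullet> (A *v ((Q n - H) *v v)) = 0"
        using sym_matsD[OF psd_sym[OF A], of v "(Q n - H) *v v"] ker by simp
      moreover have "v \<bullet> (A *v ((Q n - H) *v v)) + t n * (v \<bullet> (Q n *v ((Q n - H) *v v))) = 0"
        using arg_cong[OF eq[of n v], of "\<lambda>x. v \<bullet> x"] ker by (simp add: inner_add_right)
      ultimately show ?thesis using t(1)[of n] sym_matsD[OF Qsym, of n v "(Q n - H) *v v"] by simp
    qed
    moreover have "(\<lambda>n. (Q n *v v) \<bullet> ((Q n - H) *v v)) \<longlonglongrightarrow> (D *v v) \<bullet> ((D - H) *v v)"
      by (intro tendsto_intros tendsto_mv Q)
    ultimately show "(D *v v) \<bullet> ((D - H) *v v) = 0" by (simp add: LIMSEQ_const_iff)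
  qed
  show ?thesis using Dsym first second by (simp add: psd_proj_tangent_def A_def B_def)
qed

text \<open>By nonexpansiveness the quotients stay in a ball, so they converge along a subsequence
  of any positive null sequence, and \<open>psd_proj_tangent_unique\<close> makes all these limits
  equal. As \<open>dir_deriv\<close> is a bare \<open>Lim\<close>, existence of the limit is what
  gives it meaning.\<close>

lemma psd_proj_dir_deriv:
  fixes Z H :: "real ^ 'p ^ 'p"
  assumes Z: "Z \<in> sym_mats" and H: "H \<in> sym_mats"
  shows "((\<lambda>t. (psd_proj (Z + t *\<^sub>R H) - psd_proj Z) /\<^sub>R t) \<longlongrightarrow> dir_deriv psd_proj Z H) (at_right 0)"
proof -
  define Q where "Q = (\<lambda>t :: real. (psd_proj (Z + t *\<^sub>R H) - psd_proj Z) /\<^sub>R t)"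
  have bdd: "Q t \<in> cball 0 (norm H)" if "t > 0" for t
  proof -
    have "norm (Q t) = norm (psd_proj (Z + t *\<^sub>R H) - psd_proj Z) / t"
      using that by (simp add: Q_def divide_inverse mult.commute)
    then show ?thesis
      using psd_proj_lipschitz[of "Z + t *\<^sub>R H" Z] that by (simp add: pos_divide_le_eq mult.commute)
  qed
  have sub: "\<exists>r D. strict_mono r \<and> (Q \<circ> X \<circ> r) \<longlonglongrightarrow> D \<and>
      psd_proj_tangent (psd_proj Z) (psd_proj Z - Z) H D"
    if X: "\<And>n. X n > 0" "X \<longlonglongrightarrow> 0" for X
  proof -
    have "\<forall>n. (Q \<circ> X) n \<in> cball 0 (norm H)" using bdd X(1) by simp
    then obtain D r where r: "strict_mono (r :: nat \<Rightarrow> nat)" and lim: "((Q \<circ> X) \<circ> r) \<longlonglongrightarrow> D"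
      using seq_compactE[OF compact_imp_seq_compact[OF compact_cball]] by metis
    then have "psd_proj_tangent (psd_proj Z) (psd_proj Z - Z) H D"
      using psd_proj_quotient_tangent[OF Z H, of "X \<circ> r" D] X LIMSEQ_subseq_LIMSEQ[OF X(2) r]
      by (simp add: Q_def comp_def)
    then show ?thesis using r lim by blast
  qed
  \<comment> \<open>This null sequence merely supplies one solution of the tangent
    conditions.\<close>
  obtain D where D: "psd_proj_tangent (psd_proj Z) (psd_proj Z - Z) H D"
    using sub[of "\<lambda>n. inverse (real (Suc n))"] LIMSEQ_inverse_real_of_nat by auto
  have "(Q \<longlongrightarrow> D) (at_right 0)"
    unfolding tendsto_at_iff_sequentially
  proof (intro allI impI, rule ccontr)
    fix X :: "nat \<Rightarrow> real"
    assume X: "\<forall>i. X i \<in> {0<..} - {0}" and X0: "X \<longlonglongrightarrow> 0" and "\<not> (Q \<circ> X) \<longlonglongrightarrow> D"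
    then obtain e where e: "e > 0" and "\<not> (\<forall>\<^sub>F n in sequentially. dist ((Q \<circ> X) n) D < e)"
      by (auto simp: tendsto_iff)
    \<comment> \<open>The terms selected by \<open>s\<close> stay at distance at least
      \<open>e\<close> from \<open>D\<close>, yet a further subsequence must converge to
      \<open>D\<close>.\<close>
    then obtain s where s: "strict_mono (s :: nat \<Rightarrow> nat)" and far: "\<And>n. \<not> dist ((Q \<circ> X) (s n)) D < e"
      using not_eventually_sequentiallyD by blast
    have Xpos: "\<And>n. X n > 0" using X by simp
    obtain r D' where "strict_mono r" "(Q \<circ> (X \<circ> s) \<circ> r) \<longlonglongrightarrow> D'"
      "psd_proj_tangent (psd_proj Z) (psd_proj Z - Z) H D'"
      using sub[of "X \<circ> s"] Xpos LIMSEQ_subseq_LIMSEQ[OF X0 s] by auto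
    moreover from this have "D' = D"
      using psd_proj_tangent_unique[OF psd_proj_in psd_proj_complementary(1)[OF Z] _ D] by blast
    ultimately have "(Q \<circ> (X \<circ> s) \<circ> r) \<longlonglongrightarrow> D" by simp
    then have "\<forall>\<^sub>F n in sequentially. dist ((Q \<circ> (X \<circ> s) \<circ> r) n) D < e" using e by (rule tendstoD)
    then show False using far by (auto simp: eventually_sequentially)
  qed
  moreover from this have "dir_deriv psd_proj Z H = D"
    unfolding dir_deriv_def Q_def by (intro tendsto_Lim) auto
  ultimately show ?thesis by (simp add: Q_def)
qed

section \<open>Difference quotients along varying directions\<close>

lemma has_derivative_Hadamard:
  assumes F: "(F has_derivative F') (at a)"
    and t: "filterlim t (at_right 0) \<F>" and w: "(w \<longlongrightarrow> \<xi>) \<F>"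
  shows "((\<lambda>n. (F (a + t n *\<^sub>R w n) - F a) /\<^sub>R t n) \<longlongrightarrow> F' \<xi>) \<F>"
proof -
  \<comment> \<open>Division by zero yields zero, so this normalized remainder vanishes at
    \<open>a\<close> and is continuous there; sequences that hit \<open>a\<close> are thereby
    allowed.\<close>
  define \<rho> where "\<rho> y = (F y - F a - F' (y - a)) /\<^sub>R norm (y - a)" for y
  have lin: "bounded_linear F'" using F by (rule has_derivative_bounded_linear)
  have t0: "(t \<longlongrightarrow> 0) \<F>" and tpos: "\<forall>\<^sub>F n in \<F>. 0 < t n"
    using t by (auto simp: filterlim_at elim: eventually_mono)
  have "(\<rho> \<longlongrightarrow> 0) (at a)" using F by (simp add: has_derivative_at_within \<rho>_def[abs_def])
  moreover have "\<rho> a = 0" by (simp add: \<rho>_def)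
  ultimately have "isCont \<rho> a" by (simp add: isCont_def)
  moreover have "((\<lambda>n. a + t n *\<^sub>R w n) \<longlongrightarrow> a) \<F>"
    using tendsto_add[OF tendsto_const tendsto_scaleR[OF t0 w], of a] by simp
  ultimately have \<rho>: "((\<lambda>n. \<rho> (a + t n *\<^sub>R w n)) \<longlongrightarrow> 0) \<F>"
    using isCont_tendsto_compose \<open>\<rho> a = 0\<close> by metis
  have "((\<lambda>n. F' (w n) + norm (w n) *\<^sub>R \<rho> (a + t n *\<^sub>R w n)) \<longlongrightarrow> F' \<xi> + norm \<xi> *\<^sub>R 0) \<F>"
    by (intro tendsto_intros bounded_linear.tendsto[OF lin] w \<rho>)
  then have "((\<lambda>n. F' (w n) + norm (w n) *\<^sub>R \<rho> (a + t n *\<^sub>R w n)) \<longlongrightarrow> F' \<xi>) \<F>" by simp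
  moreover have "\<forall>\<^sub>F n in \<F>. F' (w n) + norm (w n) *\<^sub>R \<rho> (a + t n *\<^sub>R w n) =
      (F (a + t n *\<^sub>R w n) - F a) /\<^sub>R t n"
    using tpos
  proof (rule eventually_mono)
    fix n assume n: "0 < t n"
    show "F' (w n) + norm (w n) *\<^sub>R \<rho> (a + t n *\<^sub>R w n) = (F (a + t n *\<^sub>R w n) - F a) /\<^sub>R t n"
    proof (cases "w n = 0")
      case True
      then show ?thesis by (simp add: linear_0[OF bounded_linear.linear[OF lin]])
    next
      case False
      then have "norm (w n) * inverse (norm (t n *\<^sub>R w n)) = inverse (t n)"
        using n by (simp add: field_simps)
      then have "norm (w n) *\<^sub>R \<rho> (a + t n *\<^sub>R w n) = (F (a + t n *\<^sub>R w n) - F a - t n *\<^sub>R F' (w n)) /\<^sub>R t n"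
        unfolding \<rho>_def add_diff_cancel_left' linear_scale[OF bounded_linear.linear[OF lin]] scaleR_scaleR
        by (rule arg_cong)
      then show ?thesis using n by (simp add: scaleR_diff_right)
    qed
  qed
  ultimately show ?thesis by (rule Lim_transform_eventually)
qed

lemma has_derivative_in_closed_subspace:
  assumes "(F has_derivative F') (at a)" "subspace S" "closed S" "\<And>x. F x \<in> S"
  shows "F' \<xi> \<in> S"
proof (rule Lim_in_closed_set[OF assms(3)])
  show "((\<lambda>t. (F (a + t *\<^sub>R \<xi>) - F a) /\<^sub>R t) \<longlongrightarrow> F' \<xi>) (at_right 0)"
    by (rule has_derivative_Hadamard[OF assms(1)]) (auto intro: filterlim_ident)
qed (auto intro!: always_eventually subspace_scale subspace_diff assms)

text \<open>Replacing the direction \<open>H\<close> by \<open>K n\<close> changes the quotient by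
  at most \<open>norm (K n - H)\<close>, as the projection is nonexpansive.\<close>

lemma psd_proj_Hadamard:
  assumes Z: "Z \<in> sym_mats" and H: "H \<in> sym_mats"
    and t: "filterlim t (at_right 0) \<F>" and K: "(K \<longlongrightarrow> H) \<F>"
  shows "((\<lambda>n. (psd_proj (Z + t n *\<^sub>R K n) - psd_proj Z) /\<^sub>R t n) \<longlongrightarrow> dir_deriv psd_proj Z H) \<F>"
proof -
  let ?q = "\<lambda>n K. (psd_proj (Z + t n *\<^sub>R K) - psd_proj Z) /\<^sub>R t n"
  have tpos: "\<forall>\<^sub>F n in \<F>. 0 < t n"
    using t by (auto simp: filterlim_at elim: eventually_mono)
  have "((\<lambda>n. ?q n H) \<longlongrightarrow> dir_deriv psd_proj Z H) \<F>"
    by (rule filterlim_compose[OF psd_proj_dir_deriv[OF Z H] t])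
  moreover have "((\<lambda>n. ?q n (K n) - ?q n H) \<longlongrightarrow> 0) \<F>"
  proof (rule Lim_null_comparison)
    show "((\<lambda>n. norm (K n - H)) \<longlongrightarrow> 0) \<F>"
      using K by (intro tendsto_norm_zero) (simp add: Lim_null[symmetric])
    show "\<forall>\<^sub>F n in \<F>. norm (?q n (K n) - ?q n H) \<le> norm (K n - H)"
      using tpos
    proof (rule eventually_mono)
      fix n assume n: "0 < t n"
      have "norm (?q n (K n) - ?q n H) = norm (psd_proj (Z + t n *\<^sub>R K n) - psd_proj (Z + t n *\<^sub>R H)) / t n"
        using n by (simp add: scaleR_diff_right[symmetric] divide_inverse mult.commute)
      also have "\<dots> \<le> norm (t n *\<^sub>R (K n - H)) / t n"
        using psd_proj_lipschitz[of "Z + t n *\<^sub>R K n" "Z + t n *\<^sub>R H"] n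
        by (intro divide_right_mono) (simp_all add: scaleR_diff_right)
      finally show "norm (?q n (K n) - ?q n H) \<le> norm (K n - H)" using n by simp
    qed
  qed
  ultimately show ?thesis using tendsto_add by fastforce
qed

section \<open>Perturbed KKT systems\<close>

lemma gradient_eqI:
  assumes "(\<phi> has_derivative (\<lambda>h. g \<bullet> h)) (at x)"
  shows "gradient \<phi> x = g"
  unfolding gradient_def
proof (rule the_equality)
  show "GDERIV \<phi> x :> g" using assms by (simp add: gderiv_def inner_commute)
  fix D assume "GDERIV \<phi> x :> D"
  then have "(\<lambda>h. h \<bullet> D) = (\<lambda>h. g \<bullet> h)"
    using has_derivative_unique assms unfolding gderiv_def by blast
  then show "D = g" by (metis inner_commute vector_eq_ldot)
qed

text \<open>The Riesz representative of a functional. Being bounded linear in \<open>T\<close>, it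
  carries differentiability of a derivative over to the gradient.\<close>

definition riesz :: "('a::euclidean_space \<Rightarrow>\<^sub>L real) \<Rightarrow> 'a" where
  "riesz T = (\<Sum>b\<in>Basis. blinfun_apply T b *\<^sub>R b)"

lemma riesz_inner: "riesz T \<bullet> h = blinfun_apply T h"
proof -
  have "riesz T \<bullet> h = (\<Sum>b\<in>Basis. (h \<bullet> b) * blinfun_apply T b)"
    by (simp add: riesz_def inner_sum_right inner_commute[of _ h] mult.commute)
  also have "\<dots> = blinfun_apply T (\<Sum>b\<in>Basis. (h \<bullet> b) *\<^sub>R b)"
    by (simp add: blinfun.sum_right blinfun.scaleR_right)
  finally show ?thesis by (simp add: euclidean_representation)
qed

lemma bounded_linear_riesz: "bounded_linear riesz"
  unfolding riesz_def by (intro bounded_linear_intros)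

lemma norm_riesz_le: "norm (riesz T) \<le> norm T"
proof -
  have "norm (riesz T) * norm (riesz T) \<le> norm T * norm (riesz T)"
    using norm_blinfun[of T "riesz T"] riesz_inner[of T "riesz T"]
    by (simp add: power2_norm_eq_inner[symmetric] power2_eq_square)
  then show ?thesis by (cases "riesz T = 0") simp_all
qed

text \<open>\<open>g\<close> plays the gradient of the Lagrangian in \<open>x\<close>, and
  \<open>H\<close> its Hessian at the reference point. The bound by \<open>C\<close>, uniform in
  \<open>x\<close> near \<open>xbar\<close>, lets \<open>y\<close> be exchanged for
  \<open>ybar\<close>. The last assumption is the normal cone inclusion in projection form.\<close>

locale kkt_point =
  fixes g :: "real ^ 'n \<Rightarrow> real ^ 'p ^ 'p \<Rightarrow> real ^ 'n" and H :: "real ^ 'n \<Rightarrow> real ^ 'n"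
    and G :: "real ^ 'n \<Rightarrow> real ^ 'p ^ 'p" and dG :: "real ^ 'n \<Rightarrow> real ^ 'p ^ 'p"
    and xbar :: "real ^ 'n" and ybar :: "real ^ 'p ^ 'p" and C :: real
  assumes G_sym: "G x \<in> sym_mats"
    and G_deriv: "(G has_derivative dG) (at xbar)"
    and g_deriv: "((\<lambda>x. g x ybar) has_derivative H) (at xbar)"
    and g_Lipschitz: "\<forall>\<^sub>F x in nhds xbar. \<forall>y. norm (g x y - g x ybar) \<le> C * norm (y - ybar)"
    and stationary: "g xbar ybar = 0"
    and ybar_sym: "ybar \<in> sym_mats"
    and complementary: "G xbar = psd_proj (G xbar + ybar)"
begin

definition solves :: "real ^ 'n \<Rightarrow> real ^ 'p ^ 'p \<Rightarrow> real ^ 'n \<Rightarrow> real ^ 'p ^ 'p \<Rightarrow> bool" where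
  "solves p q x y \<longleftrightarrow> p = g x y \<and> y \<in> sym_mats \<and> q + G x = psd_proj (q + G x + y)"

definition critical :: "real ^ 'n \<Rightarrow> bool" where
  "critical \<xi> \<longleftrightarrow> H \<xi> = 0 \<and> dG \<xi> = dir_deriv psd_proj (G xbar + ybar) (dG \<xi>)"

definition calm :: "real \<Rightarrow> real \<Rightarrow> (real ^ 'n) set \<Rightarrow> (real ^ 'p ^ 'p) set \<Rightarrow> bool" where
  "calm \<epsilon> l U W \<longleftrightarrow> (\<forall>p\<in>U. \<forall>q\<in>W. \<forall>x y. solves p q x y \<longrightarrow> (x, y) \<in> cball (xbar, ybar) \<epsilon> \<longrightarrow>
    norm (x - xbar) \<le> l * (norm p + norm q + norm (y - ybar)))"

lemma Z_sym: "G xbar + ybar \<in> sym_mats"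
  by (intro subspace_add[OF subspace_sym_mats] G_sym ybar_sym)

lemma dG_sym: "dG \<xi> \<in> sym_mats"
  by (rule has_derivative_in_closed_subspace[OF G_deriv subspace_sym_mats closed_sym_mats G_sym])

text \<open>If the estimate fails at every scale, the violating points have \<open>p\<close>,
  \<open>q\<close> and \<open>y - ybar\<close> of smaller order than \<open>x - xbar\<close>. The
  normalized displacements cluster at a unit vector, and dividing the KKT equations by
  \<open>norm (x - xbar)\<close> shows that this vector is critical.\<close>

lemma not_calm_imp_critical:
  assumes nc: "\<And>n :: nat. \<not> calm (inverse (Suc n)) (Suc n) (ball 0 (inverse (Suc n))) (sym_mats \<inter> ball 0 (inverse (Suc n)))"
  shows "\<exists>\<xi>. critical \<xi> \<and> \<xi> \<noteq> 0"
proof -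
  have "\<exists>p q x y. norm p < inverse (Suc n) \<and> norm q < inverse (Suc n) \<and> solves p q x y \<and>
      dist xbar x \<le> inverse (Suc n) \<and>
      Suc n * (norm p + norm q + norm (y - ybar)) < norm (x - xbar)" for n
  proof -
    obtain p q x y where "norm p < inverse (Suc n)" "norm q < inverse (Suc n)" "solves p q x y"
      and xy: "(x, y) \<in> cball (xbar, ybar) (inverse (Suc n))"
      and "Suc n * (norm p + norm q + norm (y - ybar)) < norm (x - xbar)"
      using nc[of n] by (auto simp: calm_def not_le)
    moreover have "dist xbar x \<le> inverse (Suc n)"
      using xy dist_fst_le[of "(xbar, ybar)" "(x, y)"] by simp
    ultimately show ?thesis by blast
  qed
  then obtain p q x y where sol: "\<And>n. solves (p n) (q n) (x n) (y n)"
    and xn: "\<And>n. dist xbar (x n) \<le> inverse (Suc n)"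
    and big: "\<And>n. Suc n * (norm (p n) + norm (q n) + norm (y n - ybar)) < norm (x n - xbar)"
    by metis
  define t where "t n = norm (x n - xbar)" for n
  define w where "w n = (x n - xbar) /\<^sub>R t n" for n
  \<comment> \<open>The inequality \<open>big\<close> is strict with a nonnegative left side, which
    excludes \<open>x n = xbar\<close>.\<close>
  have tpos: "0 < t n" for n
    unfolding t_def by (rule le_less_trans[OF _ big[of n]]) simp
  have t0: "t \<longlonglongrightarrow> 0"
    by (rule Lim_null_comparison[OF _ LIMSEQ_inverse_real_of_nat])
      (use xn in \<open>simp add: t_def dist_norm norm_minus_commute\<close>)
  have wn: "w n \<in> sphere 0 1" for n using tpos[of n] by (simp add: w_def t_def)
  obtain \<xi> r where \<xi>: "\<xi> \<in> sphere 0 1" and r: "strict_mono (r :: nat \<Rightarrow> nat)" and wlim: "(w \<circ> r) \<longlonglongrightarrow> \<xi>"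
    using seq_compactE[OF compact_imp_seq_compact[OF compact_sphere], of w 0 1] wn by metis
  have tr: "filterlim (\<lambda>n. t (r n)) (at_right 0) sequentially"
    using LIMSEQ_subseq_LIMSEQ[OF t0 r] tpos by (intro tendsto_imp_filterlim_at_right) (simp_all add: comp_def)
  have xr: "x n = xbar + t n *\<^sub>R w n" for n using tpos[of n] by (simp add: w_def)
  have x0: "x \<longlonglongrightarrow> xbar"
    using t0 unfolding t_def by (metis (no_types) Lim_null tendsto_norm_zero_iff)
  have small: "(norm (p n) + norm (q n) + norm (y n - ybar)) / t n \<le> inverse (Suc n)" for n
    using big[of n] tpos[of n] by (simp add: t_def[symmetric] field_simps)
  have small_lim: "(\<lambda>n. u (r n) /\<^sub>R t (r n)) \<longlonglongrightarrow> 0"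
    if "\<And>n. norm (u n) \<le> norm (p n) + norm (q n) + norm (y n - ybar)" for u :: "nat \<Rightarrow> 'z::real_normed_vector"
  proof -
    have "(\<lambda>n. u n /\<^sub>R t n) \<longlonglongrightarrow> 0"
    proof (rule Lim_null_comparison[OF _ LIMSEQ_inverse_real_of_nat], rule always_eventually, rule allI)
      fix n
      have "norm (u n /\<^sub>R t n) = norm (u n) / t n" using tpos[of n] by (simp add: divide_inverse mult.commute)
      also have "\<dots> \<le> (norm (p n) + norm (q n) + norm (y n - ybar)) / t n"
        using that tpos[of n] by (intro divide_right_mono) auto
      finally show "norm (u n /\<^sub>R t n) \<le> inverse (real (Suc n))" using small[of n] by simp
    qed
    from LIMSEQ_subseq_LIMSEQ[OF this r] show ?thesis by (simp add: comp_def)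
  qed
  have q0: "(\<lambda>n. q (r n) /\<^sub>R t (r n)) \<longlonglongrightarrow> 0" and y0: "(\<lambda>n. (y (r n) - ybar) /\<^sub>R t (r n)) \<longlonglongrightarrow> 0"
    and p0: "(\<lambda>n. p (r n) /\<^sub>R t (r n)) \<longlonglongrightarrow> 0"
    by (rule small_lim; simp)+
  have Glim: "(\<lambda>n. (G (x (r n)) - G xbar) /\<^sub>R t (r n)) \<longlonglongrightarrow> dG \<xi>"
    using has_derivative_Hadamard[OF G_deriv tr wlim] by (simp add: xr[symmetric])
  have glim: "(\<lambda>n. g (x (r n)) ybar /\<^sub>R t (r n)) \<longlonglongrightarrow> H \<xi>"
    using has_derivative_Hadamard[OF g_deriv tr wlim] by (simp add: xr[symmetric] stationary)
  \<comment> \<open>The same quotients also tend to zero: both \<open>p n = g (x n) (y n)\<close>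
    and the error of exchanging \<open>y n\<close> for \<open>ybar\<close> are of smaller order than
    \<open>t n\<close>.\<close>
  have "(\<lambda>n. g (x (r n)) ybar /\<^sub>R t (r n)) \<longlonglongrightarrow> 0"
  proof (rule Lim_null_comparison)
    have "(\<lambda>n. norm (p (r n) /\<^sub>R t (r n)) + C * norm ((y (r n) - ybar) /\<^sub>R t (r n))) \<longlonglongrightarrow> norm (0 :: real ^ 'n) + C * norm (0 :: real ^ 'p ^ 'p)"
      by (intro tendsto_intros p0 y0)
    then show "(\<lambda>n. norm (p (r n) /\<^sub>R t (r n)) + C * norm ((y (r n) - ybar) /\<^sub>R t (r n))) \<longlonglongrightarrow> 0" by simp
    have "\<forall>\<^sub>F n in sequentially. \<forall>y. norm (g (x (r n)) y - g (x (r n)) ybar) \<le> C * norm (y - ybar)"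
      using eventually_compose_filterlim[OF g_Lipschitz LIMSEQ_subseq_LIMSEQ[OF x0 r]] by (simp add: comp_def)
    then show "\<forall>\<^sub>F n in sequentially. norm (g (x (r n)) ybar /\<^sub>R t (r n)) \<le>
        norm (p (r n) /\<^sub>R t (r n)) + C * norm ((y (r n) - ybar) /\<^sub>R t (r n))"
    proof (rule eventually_mono)
      fix n assume "\<forall>y. norm (g (x (r n)) y - g (x (r n)) ybar) \<le> C * norm (y - ybar)"
      then have "norm (p (r n) - g (x (r n)) ybar) \<le> C * norm (y (r n) - ybar)"
        using sol[of "r n"] by (simp add: solves_def)
      then have "norm (g (x (r n)) ybar) \<le> norm (p (r n)) + C * norm (y (r n) - ybar)"
        using norm_triangle_sub[of "g (x (r n)) ybar" "p (r n)"] by (simp add: norm_minus_commute)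
      then have "inverse (t (r n)) * norm (g (x (r n)) ybar) \<le> inverse (t (r n)) * (norm (p (r n)) + C * norm (y (r n) - ybar))"
        using tpos[of "r n"] by (intro mult_left_mono) simp_all
      then show "norm (g (x (r n)) ybar /\<^sub>R t (r n)) \<le>
        norm (p (r n) /\<^sub>R t (r n)) + C * norm ((y (r n) - ybar) /\<^sub>R t (r n))"
        using tpos[of "r n"] by (simp add: distrib_left mult_ac)
    qed
  qed
  with glim have "H \<xi> = 0" using LIMSEQ_unique by blast
  moreover have "dG \<xi> = dir_deriv psd_proj (G xbar + ybar) (dG \<xi>)"
  proof (rule LIMSEQ_unique)
    \<comment> \<open>\<open>?A\<close> is the quotient of \<open>q + G x\<close> and
      \<open>?K\<close> that of \<open>q + G x + y\<close>. By the projection equation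
      \<open>?A\<close> is also the quotient of the projection along \<open>?K\<close>, so it has
      two limits to compare.\<close>
    let ?A = "\<lambda>n. (G (x (r n)) - G xbar) /\<^sub>R t (r n) + q (r n) /\<^sub>R t (r n)"
    let ?K = "\<lambda>n. ?A n + (y (r n) - ybar) /\<^sub>R t (r n)"
    have "?A \<longlonglongrightarrow> dG \<xi> + 0" by (intro tendsto_intros Glim q0)
    then show A: "?A \<longlonglongrightarrow> dG \<xi>" by simp
    have "?K \<longlonglongrightarrow> dG \<xi> + 0" by (intro tendsto_intros A y0)
    then have "?K \<longlonglongrightarrow> dG \<xi>" by simp
    from psd_proj_Hadamard[OF Z_sym dG_sym tr this]
    have lim: "(\<lambda>n. (psd_proj (G xbar + ybar + t (r n) *\<^sub>R ?K n) - psd_proj (G xbar + ybar)) /\<^sub>R t (r n))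
      \<longlonglongrightarrow> dir_deriv psd_proj (G xbar + ybar) (dG \<xi>)" .
    have "(psd_proj (G xbar + ybar + t (r n) *\<^sub>R ?K n) - psd_proj (G xbar + ybar)) /\<^sub>R t (r n) = ?A n" for n
    proof -
      have "G xbar + ybar + t (r n) *\<^sub>R ?K n = q (r n) + G (x (r n)) + y (r n)"
        using tpos[of "r n"] by (simp add: scaleR_add_right)
      then have "psd_proj (G xbar + ybar + t (r n) *\<^sub>R ?K n) = q (r n) + G (x (r n))"
        using sol[of "r n"] by (simp add: solves_def)
      then show ?thesis using complementary by (simp add: scaleR_add_right scaleR_diff_right)
    qed
    then show "?A \<longlonglongrightarrow> dir_deriv psd_proj (G xbar + ybar) (dG \<xi>)" using lim by simp
  qed
  ultimately have "critical \<xi>" by (simp add: critical_def)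
  then show ?thesis using \<xi> by auto
qed

text \<open>A critical direction \<open>\<xi>\<close> generates the perturbed KKT points
  \<open>x\<^sub>t = xbar + t \<xi>\<close>, \<open>y\<^sub>t = z\<^sub>t - \<Pi>(z\<^sub>t)\<close> with \<open>z\<^sub>t = G xbar + ybar + t G'(xbar) \<xi>\<close>, for which
  \<open>p\<^sub>1\<close>, \<open>p\<^sub>2\<close> and \<open>y\<^sub>t - ybar\<close> are all \<open>o(t)\<close>.\<close>

lemma calm_imp_critical_zero:
  assumes eps: "\<epsilon> > 0" and U: "open U" "0 \<in> U" and W: "openin (top_of_set sym_mats) W" "0 \<in> W"
    and calm: "calm \<epsilon> l U W" and crit: "critical \<xi>"
  shows "\<xi> = 0"
proof -
  define Z where "Z = G xbar + ybar"
  define z where "z t = Z + t *\<^sub>R dG \<xi>" for t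
  define y where "y t = z t - psd_proj (z t)" for t
  define x where "x t = xbar + t *\<^sub>R \<xi>" for t
  define q where "q t = psd_proj (z t) - G (x t)" for t
  define p where "p t = g (x t) (y t)" for t
  let ?F = "at_right (0 :: real)"
  have tF: "filterlim (\<lambda>t. t) (at_right 0) ?F" by (rule filterlim_ident)
  have t0: "((\<lambda>t. t) \<longlongrightarrow> 0) ?F" by (rule tendsto_ident_at)
  have tpos: "\<forall>\<^sub>F t in ?F. 0 < t" by (rule eventually_at_right_less)
  have z_sym: "z t \<in> sym_mats" for t
    unfolding z_def Z_def
    by (intro subspace_add[OF subspace_sym_mats] subspace_scale[OF subspace_sym_mats] G_sym ybar_sym dG_sym)
  have q_sym: "q t \<in> sym_mats" for t
    unfolding q_def by (intro subspace_diff[OF subspace_sym_mats] G_sym psd_sym psd_proj_in)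
  \<comment> \<open>\<open>z t\<close> splits into \<open>q t + G (x t)\<close>, its projection, and
    \<open>y t\<close>, so the equations hold for every \<open>t\<close>.\<close>
  have sol: "solves (p t) (q t) (x t) (y t)" for t
    unfolding solves_def p_def q_def y_def
    by (simp add: subspace_diff[OF subspace_sym_mats] z_sym psd_sym psd_proj_in)
  have proj: "((\<lambda>t. (psd_proj (z t) - G xbar) /\<^sub>R t) \<longlongrightarrow> dG \<xi>) ?F"
    using psd_proj_dir_deriv[OF Z_sym dG_sym, of \<xi>] crit complementary
    by (simp add: critical_def z_def Z_def)
  have Glim: "((\<lambda>t. (G (x t) - G xbar) /\<^sub>R t) \<longlongrightarrow> dG \<xi>) ?F"
    unfolding x_def by (rule has_derivative_Hadamard[OF G_deriv tF tendsto_const])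
  have glim: "((\<lambda>t. g (x t) ybar /\<^sub>R t) \<longlongrightarrow> 0) ?F"
    using has_derivative_Hadamard[OF g_deriv tF tendsto_const, of \<xi>] crit
    by (simp add: x_def stationary critical_def)
  have qlim: "((\<lambda>t. q t /\<^sub>R t) \<longlongrightarrow> 0) ?F"
    using tendsto_diff[OF proj Glim] by (simp add: q_def scaleR_diff_right)
  have ylim: "((\<lambda>t. (y t - ybar) /\<^sub>R t) \<longlongrightarrow> 0) ?F"
  proof -
    have "((\<lambda>t. dG \<xi> - (psd_proj (z t) - G xbar) /\<^sub>R t) \<longlongrightarrow> dG \<xi> - dG \<xi>) ?F"
      by (intro tendsto_intros proj)
    then have "((\<lambda>t. dG \<xi> - (psd_proj (z t) - G xbar) /\<^sub>R t) \<longlongrightarrow> 0) ?F" by simp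
    \<comment> \<open>By \<open>complementary\<close>, \<open>y t - ybar\<close> is
      \<open>t *\<^sub>R dG \<xi>\<close> minus the increment of the projection, and criticality
      makes the two agree to first order.\<close>
    moreover have "\<forall>\<^sub>F t in ?F. dG \<xi> - (psd_proj (z t) - G xbar) /\<^sub>R t = (y t - ybar) /\<^sub>R t"
      using tpos by (rule eventually_mono) (simp add: y_def z_def Z_def scaleR_diff_right scaleR_add_right)
    ultimately show ?thesis by (rule Lim_transform_eventually)
  qed
  have xlim: "(x \<longlongrightarrow> xbar) ?F"
    using tendsto_add[OF tendsto_const tendsto_scaleR[OF t0 tendsto_const], of xbar \<xi>]
    by (simp add: x_def[abs_def])
  have "\<forall>\<^sub>F t in ?F. \<forall>y. norm (g (x t) y - g (x t) ybar) \<le> C * norm (y - ybar)"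
    by (rule eventually_compose_filterlim[OF g_Lipschitz xlim])
  then have Lip: "\<forall>\<^sub>F t in ?F. norm (p t - g (x t) ybar) \<le> C * norm (y t - ybar)"
    by (rule eventually_mono) (simp add: p_def)
  have plim: "((\<lambda>t. p t /\<^sub>R t) \<longlongrightarrow> 0) ?F"
  proof (rule Lim_null_comparison)
    have "((\<lambda>t. norm (g (x t) ybar /\<^sub>R t) + C * norm ((y t - ybar) /\<^sub>R t)) \<longlongrightarrow>
        norm (0 :: real ^ 'n) + C * norm (0 :: real ^ 'p ^ 'p)) ?F"
      by (intro tendsto_intros glim ylim)
    then show "((\<lambda>t. norm (g (x t) ybar /\<^sub>R t) + C * norm ((y t - ybar) /\<^sub>R t)) \<longlongrightarrow> 0) ?F" by simp
    show "\<forall>\<^sub>F t in ?F. norm (p t /\<^sub>R t) \<le> norm (g (x t) ybar /\<^sub>R t) + C * norm ((y t - ybar) /\<^sub>R t)"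
      using Lip tpos
    proof eventually_elim
      fix t :: real assume L: "norm (p t - g (x t) ybar) \<le> C * norm (y t - ybar)" and t: "0 < t"
      have "norm (p t) \<le> norm (g (x t) ybar) + C * norm (y t - ybar)"
        using L norm_triangle_sub[of "p t" "g (x t) ybar"] by simp
      then have "inverse t * norm (p t) \<le> inverse t * (norm (g (x t) ybar) + C * norm (y t - ybar))"
        using t by (intro mult_left_mono) simp_all
      then show "norm (p t /\<^sub>R t) \<le> norm (g (x t) ybar /\<^sub>R t) + C * norm ((y t - ybar) /\<^sub>R t)"
        using t by (simp add: distrib_left mult_ac)
    qed
  qed
  have null: "(u \<longlongrightarrow> 0) ?F" if "((\<lambda>t. u t /\<^sub>R t) \<longlongrightarrow> 0) ?F" for u :: "real \<Rightarrow> 'z::real_normed_vector"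
  proof -
    have "((\<lambda>t. t *\<^sub>R (u t /\<^sub>R t)) \<longlongrightarrow> 0) ?F"
      using tendsto_scaleR[OF t0 that] by simp
    moreover have "\<forall>\<^sub>F t in ?F. t *\<^sub>R (u t /\<^sub>R t) = u t"
      using tpos by (rule eventually_mono) simp
    ultimately show ?thesis by (rule Lim_transform_eventually)
  qed
  have "\<forall>\<^sub>F t in ?F. p t \<in> U" using topological_tendstoD[OF null[OF plim] U] .
  moreover have "\<forall>\<^sub>F t in ?F. q t \<in> W"
  proof -
    obtain T where "open T" and T: "W = sym_mats \<inter> T" using W(1) by (auto simp: openin_open)
    then have "\<forall>\<^sub>F t in ?F. q t \<in> T" using topological_tendstoD[OF null[OF qlim]] W(2) by blast
    then show ?thesis by (rule eventually_mono) (simp add: T q_sym)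
  qed
  moreover have "\<forall>\<^sub>F t in ?F. (x t, y t) \<in> cball (xbar, ybar) \<epsilon>"
  proof -
    have "(y \<longlongrightarrow> ybar) ?F" using null[OF ylim] by (simp add: Lim_null[symmetric])
    then have "((\<lambda>t. (x t, y t)) \<longlongrightarrow> (xbar, ybar)) ?F" by (intro tendsto_Pair xlim)
    then have "\<forall>\<^sub>F t in ?F. dist (x t, y t) (xbar, ybar) < \<epsilon>" using eps by (rule tendstoD)
    then show ?thesis by (rule eventually_mono) (simp add: dist_commute)
  qed
  ultimately have "\<forall>\<^sub>F t in ?F. norm (x t - xbar) \<le> l * (norm (p t) + norm (q t) + norm (y t - ybar))"
    by eventually_elim (use calm sol in \<open>auto simp: calm_def\<close>)
  \<comment> \<open>Division by \<open>t\<close> leaves the constant \<open>norm \<xi>\<close> on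
    the left, while the right side tends to zero.\<close>
  then have "\<forall>\<^sub>F t in ?F. norm \<xi> \<le> l * (norm (p t /\<^sub>R t) + norm (q t /\<^sub>R t) + norm ((y t - ybar) /\<^sub>R t))"
    using tpos
  proof eventually_elim
    fix t :: real
    assume "norm (x t - xbar) \<le> l * (norm (p t) + norm (q t) + norm (y t - ybar))" and t: "0 < t"
    then have "inverse t * norm (x t - xbar) \<le> inverse t * (l * (norm (p t) + norm (q t) + norm (y t - ybar)))"
      by (intro mult_left_mono) simp_all
    moreover have "inverse t * norm (x t - xbar) = norm \<xi>" using t by (simp add: x_def)
    ultimately show "norm \<xi> \<le> l * (norm (p t /\<^sub>R t) + norm (q t /\<^sub>R t) + norm ((y t - ybar) /\<^sub>R t))"
      using t by (simp add: distrib_left mult.left_commute)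
  qed
  moreover have "((\<lambda>t. l * (norm (p t /\<^sub>R t) + norm (q t /\<^sub>R t) + norm ((y t - ybar) /\<^sub>R t))) \<longlongrightarrow>
      l * (norm (0 :: real ^ 'n) + norm (0 :: real ^ 'p ^ 'p) + norm (0 :: real ^ 'p ^ 'p))) ?F"
    by (intro tendsto_intros plim qlim ylim)
  ultimately have "norm \<xi> \<le> l * (norm (0 :: real ^ 'n) + norm (0 :: real ^ 'p ^ 'p) + norm (0 :: real ^ 'p ^ 'p))"
    by (intro tendsto_lowerbound) auto
  then show ?thesis by simp
qed

text \<open>When zero is the only critical direction, the estimate holds at some scale
  \<open>inverse (Suc n)\<close>, which supplies all four witnesses at once.\<close>

lemma critical_zero_iff_calm:
  "(\<forall>\<xi>. critical \<xi> \<longrightarrow> \<xi> = 0) \<longleftrightarrow>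
    (\<exists>\<epsilon>>0. \<exists>l>0. \<exists>U W. open U \<and> 0 \<in> U \<and> openin (top_of_set sym_mats) W \<and> 0 \<in> W \<and> calm \<epsilon> l U W)"
proof
  assume i: "\<forall>\<xi>. critical \<xi> \<longrightarrow> \<xi> = 0"
  have "\<exists>n :: nat. calm (inverse (Suc n)) (Suc n) (ball 0 (inverse (Suc n))) (sym_mats \<inter> ball 0 (inverse (Suc n)))"
    using not_calm_imp_critical i by blast
  then obtain n :: nat where
    n: "calm (inverse (Suc n)) (Suc n) (ball 0 (inverse (Suc n))) (sym_mats \<inter> ball 0 (inverse (Suc n)))" by blast
  show "\<exists>\<epsilon>>0. \<exists>l>0. \<exists>U W. open U \<and> 0 \<in> U \<and> openin (top_of_set sym_mats) W \<and> 0 \<in> W \<and> calm \<epsilon> l U W"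
    by (intro exI[of _ "inverse (Suc n)"] exI[of _ "real (Suc n)"] exI[of _ "ball 0 (inverse (Suc n))"]
        exI[of _ "sym_mats \<inter> ball 0 (inverse (Suc n))"] conjI n)
      (simp_all add: subspace_0[OF subspace_sym_mats] openin_open_Int)
qed (use calm_imp_critical_zero in blast)

end

theorem theorem4p1:
  fixes f :: "real ^ 'n \<Rightarrow> real"
    and G :: "real ^ 'n \<Rightarrow> real ^ 'p ^ 'p"
    and xbar :: "real ^ 'n" and ybar :: "real ^ 'p ^ 'p"
  assumes f_C2: "twice_cont_diff f"
    and G_sym: "\<And>x. G x \<in> sym_mats"
    and G_C2: "twice_cont_diff G"
    and KKT: "(xbar, ybar) \<in> S_KKT f G 0 0"
  shows
    "(\<forall>\<xi>::real ^ 'n.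
        hessian (\<lambda>x. lagrangian f G x ybar) xbar \<xi> = 0 \<and>
        frechet_derivative G (at xbar) \<xi> -
          dir_deriv (closest_point psd_cone) (G xbar + ybar) (frechet_derivative G (at xbar) \<xi>) = 0
        \<longrightarrow> \<xi> = 0)
     \<longleftrightarrow>
     (\<exists>\<epsilon>>0. \<exists>l>0. \<exists>U W.
        open U \<and> 0 \<in> U \<and> openin (top_of_set sym_mats) W \<and> 0 \<in> W \<and>
        (\<forall>p\<^sub>1\<in>U. \<forall>p\<^sub>2\<in>W. \<forall>(x, y) \<in> S_KKT f G p\<^sub>1 p\<^sub>2 \<inter> cball (xbar, ybar) \<epsilon>.
           norm (x - xbar) \<le> l * (norm p\<^sub>1 + norm p\<^sub>2 + norm (y - ybar))))"
proof -
  obtain f' :: "real ^ 'n \<Rightarrow> (real ^ 'n) \<Rightarrow>\<^sub>L real" and f'' where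
    f': "\<And>x. (f has_derivative blinfun_apply (f' x)) (at x)" and
    f'': "\<And>x. (f' has_derivative blinfun_apply (f'' x)) (at x)"
    using f_C2 unfolding twice_cont_diff_def by blast
  obtain G' :: "real ^ 'n \<Rightarrow> (real ^ 'n) \<Rightarrow>\<^sub>L (real ^ 'p ^ 'p)" and G'' where
    G': "\<And>x. (G has_derivative blinfun_apply (G' x)) (at x)" and
    G'': "\<And>x. (G' has_derivative blinfun_apply (G'' x)) (at x)"
    using G_C2 unfolding twice_cont_diff_def by blast
  define g where "g x y = riesz (f' x + (blinfun_inner_right y o\<^sub>L G' x))" for x y
  have grad: "gradient (\<lambda>u. lagrangian f G u y) x = g x y" for x y
  proof (rule gradient_eqI)
    have "((\<lambda>u. f u + y \<bullet> G u) has_derivative (\<lambda>h. f' x h + y \<bullet> G' x h)) (at x)"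
      by (intro derivative_intros f' G' bounded_linear.has_derivative[OF bounded_linear_inner_right])
    then show "((\<lambda>u. lagrangian f G u y) has_derivative (\<lambda>h. g x y \<bullet> h)) (at x)"
      by (simp add: lagrangian_def g_def riesz_inner blinfun.add_left)
  qed
  define H where "H = hessian (\<lambda>x. lagrangian f G x ybar) xbar"
  have "(\<lambda>x. g x ybar) differentiable at xbar"
    unfolding differentiable_def g_def
    by (rule exI, rule bounded_linear.has_derivative[OF bounded_linear_riesz], rule has_derivative_add,
        rule f'', rule bounded_linear.has_derivative[OF bounded_bilinear.bounded_linear_right[OF bounded_bilinear_blinfun_compose]], rule G'')
  \<comment> \<open>\<open>hessian\<close> differentiates the gradient as a function, so the
    pointwise formula has to become an equality of functions.\<close>
  moreover have "gradient (\<lambda>u. lagrangian f G u ybar) = (\<lambda>x. g x ybar)" by (rule ext, rule grad)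
  ultimately have H: "((\<lambda>x. g x ybar) has_derivative H) (at xbar)"
    by (simp add: H_def hessian_def frechet_derivative_works)
  define dG where "dG = frechet_derivative G (at xbar)"
  have dG: "(G has_derivative dG) (at xbar)"
    unfolding dG_def using G' frechet_derivative_works by (blast intro: differentiableI)
  have KKT_iff: "(x, y) \<in> S_KKT f G p q \<longleftrightarrow>
      p = g x y \<and> y \<in> sym_mats \<and> q + G x = psd_proj (q + G x + y)" for p q x y
  proof -
    have "q \<in> (\<lambda>v. - G x + v) ` normal_cone sym_mats y nsd_cone \<longleftrightarrow>
        q + G x \<in> normal_cone sym_mats y nsd_cone"
      by (auto simp: image_iff algebra_simps intro!: bexI[of _ "q + G x"])
    then show ?thesis by (simp add: S_KKT_def grad normal_cone_nsd_iff)
  qed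
  \<comment> \<open>\<open>g x y\<close> is affine in \<open>y\<close> with slope bounded by
    \<open>norm (G' x)\<close>, which by continuity stays below \<open>norm (G' xbar) + 1\<close>
    near \<open>xbar\<close>.\<close>
  interpret kkt_point g H G dG xbar ybar "norm (G' xbar) + 1"
  proof
    have "isCont G' xbar" using G'' has_derivative_continuous by blast
    then have "((\<lambda>x. norm (G' x)) \<longlongrightarrow> norm (G' xbar)) (nhds xbar)"
      by (intro tendsto_norm) (simp add: continuous_at tendsto_at_iff_tendsto_nhds)
    then have "\<forall>\<^sub>F x in nhds xbar. norm (G' x) < norm (G' xbar) + 1"
      by (rule order_tendstoD) simp
    then show "\<forall>\<^sub>F x in nhds xbar. \<forall>y. norm (g x y - g x ybar) \<le> (norm (G' xbar) + 1) * norm (y - ybar)"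
    proof (rule eventually_mono, intro allI)
      fix x y assume x: "norm (G' x) < norm (G' xbar) + 1"
      have "g x y - g x ybar = riesz (blinfun_inner_right (y - ybar) o\<^sub>L G' x)"
        unfolding g_def linear_diff[OF bounded_linear.linear[OF bounded_linear_riesz], symmetric]
        by (rule arg_cong[of _ _ riesz], rule blinfun_eqI)
          (simp add: blinfun.add_left blinfun.diff_left inner_diff_left)
      then have "norm (g x y - g x ybar) \<le> norm (blinfun_inner_right (y - ybar)) * norm (G' x)"
        using norm_riesz_le norm_blinfun_compose order_trans by metis
      also have "\<dots> \<le> norm (y - ybar) * (norm (G' xbar) + 1)"
      proof (intro mult_mono)
        show "norm (blinfun_inner_right (y - ybar)) \<le> norm (y - ybar)"
          by (rule norm_blinfun_bound) (simp_all add: Cauchy_Schwarz_ineq2)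
      qed (use x in simp_all)
      finally show "norm (g x y - g x ybar) \<le> (norm (G' xbar) + 1) * norm (y - ybar)"
        by (simp add: mult.commute)
    qed
  qed (use KKT G_sym H dG in \<open>auto simp: KKT_iff\<close>)
  have calm_iff: "calm \<epsilon> l U W \<longleftrightarrow> (\<forall>p\<^sub>1\<in>U. \<forall>p\<^sub>2\<in>W. \<forall>(x, y) \<in> S_KKT f G p\<^sub>1 p\<^sub>2 \<inter> cball (xbar, ybar) \<epsilon>.
      norm (x - xbar) \<le> l * (norm p\<^sub>1 + norm p\<^sub>2 + norm (y - ybar)))" for \<epsilon> l U W
    unfolding calm_def solves_def using KKT_iff by blast
  show ?thesis
    using critical_zero_iff_calm unfolding calm_iff critical_def
    unfolding H_def dG_def right_minus_eq .
qed

end
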